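(* For the unweighted two-stage stochastic bipartite matching problem, the Two-Stage Online Rounding algorithm produces a matching whose expected size is at least $\frac34$ of the optimal value of $\mathrm{LP}_{\mathrm{off}}$, and hence at least $\frac34\,\mathrm{OPT}_{\mathrm{off}}$.
   Context: Setting: offline nodes $I$, online batches $B_1,B_2$, known first-stage edges $E\subseteq B_1\times I$, second-stage edges $E_\theta\subseteq B_2\times I$ for $\theta$ drawn from a known distribution $\mathcal{D}$ with finite support $\Theta$. $\mathrm{OPT}_{\mathrm{off}}$ is the expected size of a maximum matching of the full graph on $E\cup E_\theta$, $\theta\sim\mathcal{D}$. $\mathrm{LP}_{\mathrm{off}}$: maximize $\sum_{i,a}x_{ia}+\sum_{i,b}\mathbb{E}_\theta[y^\theta_{ib}]$ subject to $\sum_{a\in B_1}x_{ia}+\sum_{b\in B_2}\mathbb{E}_\theta[y^\theta_{ib}]\le1$ for all $i\in I$; $\sum_b y^\theta_{ib}\le1$ for all $i,\theta$; $\sum_i x_{ia}\le1$ for all $a\in B_1$; $\sum_iy^\theta_{ib}\le1$ for all $b,\theta$; nonnegativity; $x_{ia}=0$ for $(i,a)\notin E$ and $y^\theta_{ib}=0$ for $(i,b)\notin E_\theta$. Dependent rounding of a fractional bipartite matching: repeatedly pick a cycle or maximal path of non-integral edges, split into alternating sets $M',M''$, compute the largest $\alpha,\beta>0$ keeping feasibility when shifting $+\alpha$ on $M'$ and $-\alpha$ on $M''$ (resp. $-\beta$ on $M'$ and $+\beta$ on $M''$), apply the first shift w.p. $\beta/(\alpha+\beta)$ and the second otherwise;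 output the final integral matching, which contains each edge $e$ with probability equal to its fractional value. Two-Stage Online Rounding algorithm: given an optimal solution $(\vec x,\vec y)$ of $\mathrm{LP}_{\mathrm{off}}$, in stage one round $\vec x$ by dependent rounding to obtain $M_1$; on realization $\theta$, round $\vec y^\theta$ by dependent rounding (independently) to obtain $M_2^\theta$; return $M_1$ together with those edges of $M_2^\theta$ whose offline endpoint is not matched in $M_1$ (first-stage matches take precedence). *)

theory Defs
  imports "HOL-Probability.Probability"
begin

text \<open>
  All graphs here are bipartite, with an edge written as a pair (online node, offline node).
  The two online batches are disjoint sets over the same type, so that the full graph of a
  scenario is literally the union of the two edge sets.
\<close>

definition matching :: "('b \<times> 'i) set \<Rightarrow> ('b \<times> 'i) set \<Rightarrow> bool" where
  "matching G M \<longleftrightarrow> M \<subseteq> G \<and> (\<forall>e\<in>M. \<forall>f\<in>M. e \<noteq> f \<longrightarrow> fst e \<noteq> fst f \<and> snd e \<noteq> snd f)"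

definition max_matching_size :: "('b \<times> 'i) set \<Rightarrow> nat" where
  "max_matching_size G = Max (card ` {M. matching G M})"

definition frac_matching :: "'b set \<Rightarrow> 'i set \<Rightarrow> ('b \<times> 'i) set \<Rightarrow> ('b \<times> 'i \<Rightarrow> real) \<Rightarrow> bool" where
  "frac_matching B I G x \<longleftrightarrow>
     (\<forall>e. 0 \<le> x e) \<and> (\<forall>e. e \<notin> G \<longrightarrow> x e = 0) \<and>
     (\<forall>b\<in>B. (\<Sum>i\<in>I. x (b, i)) \<le> 1) \<and> (\<forall>i\<in>I. (\<Sum>b\<in>B. x (b, i)) \<le> 1)"

definition opt_off :: "('b \<times> 'i) set \<Rightarrow> ('t \<Rightarrow> ('b \<times> 'i) set) \<Rightarrow> 't pmf \<Rightarrow> real" where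
  "opt_off E E2 D = measure_pmf.expectation D (\<lambda>\<theta>. real (max_matching_size (E \<union> E2 \<theta>)))"

definition lp_feasible :: "'i set \<Rightarrow> 'b set \<Rightarrow> 'b set \<Rightarrow> ('b \<times> 'i) set \<Rightarrow> ('t \<Rightarrow> ('b \<times> 'i) set) \<Rightarrow> 't pmf
    \<Rightarrow> ('b \<times> 'i \<Rightarrow> real) \<Rightarrow> ('t \<Rightarrow> 'b \<times> 'i \<Rightarrow> real) \<Rightarrow> bool" where
  "lp_feasible I B1 B2 E E2 D x y \<longleftrightarrow>
     (\<forall>i\<in>I. (\<Sum>a\<in>B1. x (a, i)) + (\<Sum>b\<in>B2. measure_pmf.expectation D (\<lambda>\<theta>. y \<theta> (b, i))) \<le> 1) \<and>
     (\<forall>i\<in>I. \<forall>\<theta>\<in>set_pmf D. (\<Sum>b\<in>B2. y \<theta> (b, i)) \<le> 1) \<and>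
     (\<forall>a\<in>B1. (\<Sum>i\<in>I. x (a, i)) \<le> 1) \<and>
     (\<forall>b\<in>B2. \<forall>\<theta>\<in>set_pmf D. (\<Sum>i\<in>I. y \<theta> (b, i)) \<le> 1) \<and>
     (\<forall>e. 0 \<le> x e) \<and> (\<forall>\<theta>\<in>set_pmf D. \<forall>e. 0 \<le> y \<theta> e) \<and>
     (\<forall>e. e \<notin> E \<longrightarrow> x e = 0) \<and> (\<forall>\<theta>\<in>set_pmf D. \<forall>e. e \<notin> E2 \<theta> \<longrightarrow> y \<theta> e = 0)"

definition lp_value :: "'i set \<Rightarrow> 'b set \<Rightarrow> 'b set \<Rightarrow> 't pmf
    \<Rightarrow> ('b \<times> 'i \<Rightarrow> real) \<Rightarrow> ('t \<Rightarrow> 'b \<times> 'i \<Rightarrow> real) \<Rightarrow> real" where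
  "lp_value I B1 B2 D x y =
     (\<Sum>i\<in>I. \<Sum>a\<in>B1. x (a, i)) +
     (\<Sum>i\<in>I. \<Sum>b\<in>B2. measure_pmf.expectation D (\<lambda>\<theta>. y \<theta> (b, i)))"

definition lp_optimal :: "'i set \<Rightarrow> 'b set \<Rightarrow> 'b set \<Rightarrow> ('b \<times> 'i) set \<Rightarrow> ('t \<Rightarrow> ('b \<times> 'i) set) \<Rightarrow> 't pmf
    \<Rightarrow> ('b \<times> 'i \<Rightarrow> real) \<Rightarrow> ('t \<Rightarrow> 'b \<times> 'i \<Rightarrow> real) \<Rightarrow> bool" where
  "lp_optimal I B1 B2 E E2 D x y \<longleftrightarrow>
     lp_feasible I B1 B2 E E2 D x y \<and>
     (\<forall>x' y'. lp_feasible I B1 B2 E E2 D x' y' \<longrightarrow>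
        lp_value I B1 B2 D x' y' \<le> lp_value I B1 B2 D x y)"

definition lp_off :: "'i set \<Rightarrow> 'b set \<Rightarrow> 'b set \<Rightarrow> ('b \<times> 'i) set \<Rightarrow> ('t \<Rightarrow> ('b \<times> 'i) set) \<Rightarrow> 't pmf \<Rightarrow> real"
  where
  "lp_off I B1 B2 E E2 D = Sup {lp_value I B1 B2 D x y |x y. lp_feasible I B1 B2 E E2 D x y}"

definition frac_edges :: "('b \<times> 'i) set \<Rightarrow> ('b \<times> 'i \<Rightarrow> real) \<Rightarrow> ('b \<times> 'i) set" where
  "frac_edges G x = {e \<in> G. x e \<notin> \<int>}"

definition joins :: "'b \<times> 'i \<Rightarrow> 'b + 'i \<Rightarrow> 'b + 'i \<Rightarrow> bool" where
  "joins e u v \<longleftrightarrow> (u = Inl (fst e) \<and> v = Inr (snd e)) \<or> (u = Inr (snd e) \<and> v = Inl (fst e))"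

definition is_path :: "('b \<times> 'i) set \<Rightarrow> ('b + 'i) list \<Rightarrow> ('b \<times> 'i) list \<Rightarrow> bool" where
  "is_path F vs es \<longleftrightarrow>
     es \<noteq> [] \<and> length vs = Suc (length es) \<and> distinct vs \<and> set es \<subseteq> F \<and>
     (\<forall>k<length es. joins (es ! k) (vs ! k) (vs ! Suc k))"

text \<open>
  A path is maximal if no edge of \<open>F\<close> off the path is incident with either end point. This also
  excludes an edge from an end point back to the path, which would close a cycle; so both end
  points have degree one in \<open>F\<close>, and shifting along the path is possible in both directions.
\<close>

definition is_maximal_path :: "('b \<times> 'i) set \<Rightarrow> ('b + 'i) list \<Rightarrow> ('b \<times> 'i) list \<Rightarrow> bool" where
  "is_maximal_path F vs es \<longleftrightarrow>
     is_path F vs es \<and> (\<forall>e \<in> F - set es. \<forall>w. \<not> joins e (hd vs) w \<and> \<not> joins e (last vs) w)"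

definition is_cycle :: "('b \<times> 'i) set \<Rightarrow> ('b + 'i) list \<Rightarrow> ('b \<times> 'i) list \<Rightarrow> bool" where
  "is_cycle F vs es \<longleftrightarrow>
     3 \<le> length es \<and> length vs = length es \<and> distinct vs \<and> set es \<subseteq> F \<and>
     (\<forall>k<length es. joins (es ! k) (vs ! k) (vs ! (Suc k mod length es)))"

definition alternating_split :: "('b \<times> 'i) set \<Rightarrow> ('b \<times> 'i) set \<Rightarrow> ('b \<times> 'i) set \<Rightarrow> bool" where
  "alternating_split F M' M'' \<longleftrightarrow>
     (\<exists>vs es. (is_cycle F vs es \<or> is_maximal_path F vs es) \<and>
        M' = {es ! k |k. k < length es \<and> even k} \<and>
        M'' = {es ! k |k. k < length es \<and> odd k})"

definition shift :: "('b \<times> 'i \<Rightarrow> real) \<Rightarrow> ('b \<times> 'i) set \<Rightarrow> ('b \<times> 'i) set \<Rightarrow> real \<Rightarrow> 'b \<times> 'i \<Rightarrow> real" where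
  "shift x P N t = (\<lambda>e. x e + (if e \<in> P then t else 0) - (if e \<in> N then t else 0))"

definition largest_shift :: "'b set \<Rightarrow> 'i set \<Rightarrow> ('b \<times> 'i) set \<Rightarrow> ('b \<times> 'i \<Rightarrow> real)
    \<Rightarrow> ('b \<times> 'i) set \<Rightarrow> ('b \<times> 'i) set \<Rightarrow> real \<Rightarrow> bool" where
  "largest_shift B I G x P N t \<longleftrightarrow>
     0 < t \<and> frac_matching B I G (shift x P N t) \<and>
     (\<forall>s. frac_matching B I G (shift x P N s) \<longrightarrow> s \<le> t)"

text \<open>
  \<open>dep_rounding B I G x p\<close> states that some run of dependent rounding, started from the fractional
  matching \<open>x\<close>, has output distribution \<open>p\<close>. The algorithm leaves open which cycle or maximal
  path is picked in each round; the relation admits every choice, which may depend on the random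
  outcomes of earlier rounds.
\<close>

inductive dep_rounding :: "'b set \<Rightarrow> 'i set \<Rightarrow> ('b \<times> 'i) set \<Rightarrow> ('b \<times> 'i \<Rightarrow> real)
    \<Rightarrow> ('b \<times> 'i) set pmf \<Rightarrow> bool"
  for B :: "'b set" and I :: "'i set" and G :: "('b \<times> 'i) set" where
  integral: "frac_edges G x = {} \<Longrightarrow> dep_rounding B I G x (return_pmf {e \<in> G. x e = 1})"
| step: "\<lbrakk> alternating_split (frac_edges G x) M' M'';
           largest_shift B I G x M' M'' \<alpha>;
           largest_shift B I G x M'' M' \<beta>;
           dep_rounding B I G (shift x M' M'' \<alpha>) p;
           dep_rounding B I G (shift x M'' M' \<beta>) q \<rbrakk>
         \<Longrightarrow> dep_rounding B I G x
              (bind_pmf (bernoulli_pmf (\<beta> / (\<alpha> + \<beta>))) (\<lambda>c. if c then p else q))"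

definition combine_stages :: "('b \<times> 'i) set \<Rightarrow> ('b \<times> 'i) set \<Rightarrow> ('b \<times> 'i) set" where
  "combine_stages M1 M2 = M1 \<union> {e \<in> M2. snd e \<notin> snd ` M1}"

text \<open>
  \<open>P\<close> is the joint law of the scenario and the returned edge set. The second-stage rounding law
  \<open>q \<theta>\<close> depends only on the scenario, so \<open>M2\<close> is independent of \<open>M1\<close>.
\<close>

definition two_stage_rounding :: "'i set \<Rightarrow> 'b set \<Rightarrow> 'b set \<Rightarrow> ('b \<times> 'i) set
    \<Rightarrow> ('t \<Rightarrow> ('b \<times> 'i) set) \<Rightarrow> 't pmf \<Rightarrow> ('b \<times> 'i \<Rightarrow> real) \<Rightarrow> ('t \<Rightarrow> 'b \<times> 'i \<Rightarrow> real)
    \<Rightarrow> ('t \<times> ('b \<times> 'i) set) pmf \<Rightarrow> bool" where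
  "two_stage_rounding I B1 B2 E E2 D x y P \<longleftrightarrow>
     (\<exists>p q. dep_rounding B1 I E x p \<and>
        (\<forall>\<theta>\<in>set_pmf D. dep_rounding B2 I (E2 \<theta>) (y \<theta>) (q \<theta>)) \<and>
        P = bind_pmf p (\<lambda>M1. bind_pmf D (\<lambda>\<theta>. bind_pmf (q \<theta>) (\<lambda>M2.
              return_pmf (\<theta>, combine_stages M1 M2)))))"

end

theory Submission
  imports Defs
begin

text \<open>
  Rounding along a cycle or a maximal path \<open>M' \<union> M''\<close> keeps the fractional degree of every
  vertex, except at path ends, and these carry no other nonintegral edge. So only the edge values
  limit a shift, every round makes some edge integral, and the mean of each edge value is
  preserved. If \<open>X\<close> and \<open>Y\<close> are the LP masses that an offline node receives from the two stages,
  then by independence the node is matched with probability \<open>X + (1 - X) Y\<close>, and this is at least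
  \<open>3/4 (X + Y)\<close> because \<open>X Y \<le> (X + Y)\<^sup>2 / 4 \<le> (X + Y) / 4\<close>. Averaging a maximum
  matching of each scenario gives a feasible LP solution of value \<open>opt_off\<close>.
\<close>

subsection \<open>Shifting along balanced edge sets\<close>

text \<open>Vertices of both sides live in the sum type \<open>'b + 'i\<close>, so one degree
  statement serves online and offline nodes alike.\<close>

definition star :: "('b \<times> 'i) set \<Rightarrow> 'b + 'i \<Rightarrow> ('b \<times> 'i) set" where
  "star G v = {e \<in> G. v = Inl (fst e) \<or> v = Inr (snd e)}"

lemma star_mono: "F \<subseteq> G \<Longrightarrow> star F v \<subseteq> star G v"
  by (auto simp: star_def)

lemma finite_star: "finite G \<Longrightarrow> finite (star G v)"
  by (auto simp: star_def)

lemma sum_star_Inl: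
  fixes f :: "'b \<times> 'i \<Rightarrow> real"
  assumes "finite I" "G \<subseteq> B \<times> I" "\<And>e. e \<notin> G \<Longrightarrow> f e = 0"
  shows "sum f (star G (Inl b)) = (\<Sum>i\<in>I. f (b, i))"
proof -
  have "(\<Sum>i\<in>I. f (b, i)) = sum f (Pair b ` I)"
    by (simp add: sum.reindex inj_on_def)
  also have "\<dots> = sum f (star G (Inl b))"
    using assms by (intro sum.mono_neutral_right) (auto simp: star_def)
  finally show ?thesis by simp
qed

lemma sum_star_Inr:
  fixes f :: "'b \<times> 'i \<Rightarrow> real"
  assumes "finite B" "G \<subseteq> B \<times> I" "\<And>e. e \<notin> G \<Longrightarrow> f e = 0"
  shows "sum f (star G (Inr i)) = (\<Sum>b\<in>B. f (b, i))"
proof -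
  have "(\<Sum>b\<in>B. f (b, i)) = sum f ((\<lambda>b. (b, i)) ` B)"
    by (simp add: sum.reindex inj_on_def)
  also have "\<dots> = sum f (star G (Inr i))"
    using assms by (intro sum.mono_neutral_right) (auto simp: star_def)
  finally show ?thesis by simp
qed

text \<open>Vertices outside \<open>B\<close> and \<open>I\<close> have an empty star because
  \<open>G \<subseteq> B \<times> I\<close>, so the degree constraint may range over the whole
  type.\<close>

lemma frac_matching_iff_star:
  fixes x :: "'b \<times> 'i \<Rightarrow> real"
  assumes "finite B" "finite I" "G \<subseteq> B \<times> I"
  shows "frac_matching B I G x \<longleftrightarrow>
    (\<forall>e. 0 \<le> x e) \<and> (\<forall>e. e \<notin> G \<longrightarrow> x e = 0) \<and> (\<forall>v. sum x (star G v) \<le> 1)"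
proof -
  have empty: "star G (Inl b) = {}" if "b \<notin> B" for b
    using assms(3) that by (auto simp: star_def)
  have empty': "star G (Inr i) = {}" if "i \<notin> I" for i
    using assms(3) that by (auto simp: star_def)
  have "(\<forall>v. sum x (star G v) \<le> 1) \<longleftrightarrow>
      (\<forall>b\<in>B. (\<Sum>i\<in>I. x (b, i)) \<le> 1) \<and> (\<forall>i\<in>I. (\<Sum>b\<in>B. x (b, i)) \<le> 1)"
    if "\<forall>e. e \<notin> G \<longrightarrow> x e = 0"
  proof
    assume "\<forall>v. sum x (star G v) \<le> 1"
    then show "(\<forall>b\<in>B. (\<Sum>i\<in>I. x (b, i)) \<le> 1) \<and> (\<forall>i\<in>I. (\<Sum>b\<in>B. x (b, i)) \<le> 1)"
      using that sum_star_Inl[OF assms(2,3), of x] sum_star_Inr[OF assms(1,3), of x] by metis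
  next
    assume *: "(\<forall>b\<in>B. (\<Sum>i\<in>I. x (b, i)) \<le> 1) \<and> (\<forall>i\<in>I. (\<Sum>b\<in>B. x (b, i)) \<le> 1)"
    show "\<forall>v. sum x (star G v) \<le> 1"
    proof
      fix v :: "'b + 'i"
      show "sum x (star G v) \<le> 1"
      proof (cases v)
        case (Inl b)
        then show ?thesis
          using that * empty[of b] sum_star_Inl[OF assms(2,3), of x b] by (cases "b \<in> B") auto
      next
        case (Inr i)
        then show ?thesis
          using that * empty'[of i] sum_star_Inr[OF assms(1,3), of x i] by (cases "i \<in> I") auto
      qed
    qed
  qed
  then show ?thesis by (auto simp: frac_matching_def)
qed

lemma frac_matching_nonneg: "frac_matching B I G x \<Longrightarrow> 0 \<le> x e"
  and frac_matching_outside: "frac_matching B I G x \<Longrightarrow> e \<notin> G \<Longrightarrow> x e = 0"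
  unfolding frac_matching_def by blast+

lemma frac_matching_le_1:
  assumes "finite B" "finite I" "G \<subseteq> B \<times> I" "frac_matching B I G x"
  shows "x e \<le> 1"
proof (cases "e \<in> G")
  case True
  have "x e \<le> sum x (star G (Inl (fst e)))"
    using assms finite_subset[OF assms(3)] True
    by (intro member_le_sum) (auto simp: star_def frac_matching_nonneg)
  also have "\<dots> \<le> 1"
    using assms(4) frac_matching_iff_star[OF assms(1-3)] by blast
  finally show ?thesis .
qed (use assms(4) in \<open>simp add: frac_matching_outside\<close>)

lemma frac_edges_bounds:
  assumes "finite B" "finite I" "G \<subseteq> B \<times> I" "frac_matching B I G x" "e \<in> frac_edges G x"
  shows "0 < x e" "x e < 1"
proof -
  have "x e \<noteq> 0" "x e \<noteq> 1" using assms(5) by (auto simp: frac_edges_def)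
  moreover have "0 \<le> x e" using assms(4) by (rule frac_matching_nonneg)
  ultimately show "0 < x e" "x e < 1" using frac_matching_le_1[OF assms(1-4), of e] by auto
qed

lemma integral_edge_cases:
  assumes "finite B" "finite I" "G \<subseteq> B \<times> I" "frac_matching B I G x" "e \<notin> frac_edges G x"
  shows "x e = 0 \<or> x e = 1"
proof (cases "e \<in> G")
  case True
  then obtain n where "x e = of_int n" using assms(5) by (auto simp: frac_edges_def elim: Ints_cases)
  moreover have "0 \<le> x e" using assms(4) by (rule frac_matching_nonneg)
  ultimately show ?thesis using frac_matching_le_1[OF assms(1-4), of e] by auto
qed (use assms(4) in \<open>simp add: frac_matching_outside\<close>)

text \<open>This isolates what a shift needs from a cycle or a maximal path: at each vertex the two
  signs cancel, or at most one edge of \<open>F\<close> is present. It is symmetric in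
  \<open>P\<close> and \<open>N\<close>, so it covers both shift directions.\<close>

definition balanced :: "('b \<times> 'i) set \<Rightarrow> ('b \<times> 'i) set \<Rightarrow> ('b \<times> 'i) set \<Rightarrow> bool" where
  "balanced F P N \<longleftrightarrow> P \<inter> N = {} \<and> P \<union> N \<subseteq> F \<and> P \<union> N \<noteq> {} \<and>
     (\<forall>v. card (star P v) = card (star N v) \<or> card (star F v) \<le> 1)"

lemma balanced_sym: "balanced F P N \<Longrightarrow> balanced F N P"
  unfolding balanced_def by (metis Int_commute Un_commute)

lemma sum_star_shift:
  assumes "finite G" "P \<subseteq> G" "N \<subseteq> G"
  shows "sum (shift x P N t) (star G v) =
    sum x (star G v) + t * (real (card (star P v)) - real (card (star N v)))"
proof -
  have *: "star G v \<inter> P = star P v" "star G v \<inter> N = star N v"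
    using assms by (auto simp: star_def)
  have "sum (\<lambda>e. if e \<in> S then t else 0) (star G v) = t * real (card (star G v \<inter> S))" for S
    using finite_star[OF assms(1), of v] by (simp add: sum.If_cases)
  then show ?thesis
    by (simp add: shift_def sum.distrib sum_subtractf * right_diff_distrib)
qed

text \<open>Where the signs cancel, the degree is unchanged. Elsewhere a single nonintegral edge is
  present and every other edge at the vertex has value 0, so the degree equals one edge value and
  cannot exceed 1.\<close>

lemma shift_feasible:
  assumes fin: "finite B" "finite I" "G \<subseteq> B \<times> I" and x: "frac_matching B I G x"
    and bal: "balanced (frac_edges G x) P N"
  obtains \<epsilon> where "\<epsilon> > 0" "frac_matching B I G (shift x P N \<epsilon>)"
proof -
  let ?F = "frac_edges G x"
  \<comment> \<open>The least distance of a shifted edge value to 0 or 1; it is positive because all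
    these edges are nonintegral.\<close>
  define \<epsilon> where "\<epsilon> = Min ((\<lambda>e. min (x e) (1 - x e)) ` (P \<union> N))"
  have G: "finite G" using fin by (meson finite_SigmaI finite_subset)
  have FG: "?F \<subseteq> G" by (auto simp: frac_edges_def)
  have PN: "P \<inter> N = {}" "P \<union> N \<subseteq> ?F" "P \<union> N \<noteq> {}" using bal by (auto simp: balanced_def)
  have finPN: "finite (P \<union> N)" using PN FG G by (meson finite_subset)
  note bounds = frac_edges_bounds[OF fin x]
  have pos: "\<epsilon> > 0"
    unfolding \<epsilon>_def using finPN PN bounds by (subst Min_gr_iff) auto
  have le: "\<epsilon> \<le> x e" "\<epsilon> \<le> 1 - x e" if "e \<in> P \<union> N" for e
  proof -
    have "\<epsilon> \<le> min (x e) (1 - x e)" unfolding \<epsilon>_def using finPN that by (intro Min_le) auto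
    then show "\<epsilon> \<le> x e" "\<epsilon> \<le> 1 - x e" by auto
  qed
  let ?z = "shift x P N \<epsilon>"
  have x0: "0 \<le> x e" "e \<notin> G \<Longrightarrow> x e = 0" "sum x (star G v) \<le> 1" for e v
    using x frac_matching_iff_star[OF fin, of x] by blast+
  have z_off: "?z e = x e" if "e \<notin> ?F" for e
    using that PN by (auto simp: shift_def)
  have z_nonneg: "0 \<le> ?z e" for e
    using le[of e] x0(1)[of e] pos by (auto simp: shift_def)
  have z_le: "?z e \<le> 1" for e
    using le[of e] frac_matching_le_1[OF fin x, of e] pos PN(1) by (auto simp: shift_def)
  have "sum ?z (star G v) \<le> 1" for v
  proof (cases "card (star P v) = card (star N v)")
    case True
    then show ?thesis
      using sum_star_shift[OF G, of P N x \<epsilon> v] subset_trans[OF PN(2) FG] x0(3)[of v] by simp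
  next
    case False
    then have "card (star ?F v) \<le> 1" using bal by (auto simp: balanced_def)
    \<comment> \<open>Unequal counts mean that some shifted edge meets \<open>v\<close>, so
      \<open>v\<close> carries exactly one nonintegral edge.\<close>
    moreover have "star ?F v \<noteq> {}"
      using False star_mono[of P ?F v] star_mono[of N ?F v] PN by auto
    moreover have "finite (star ?F v)" using finite_star G FG finite_subset by metis
    ultimately obtain f where f: "star ?F v = {f}"
      by (metis card_1_singletonE card_0_eq le_antisym less_one not_le)
    then have fG: "f \<in> star G v" "f \<in> ?F" by (auto simp: star_def frac_edges_def)
    text \<open>A nonintegral edge leaves no room for an edge of value 1 at the same vertex.\<close>
    have zero: "x e = 0" if e: "e \<in> star G v - {f}" for e
    proof (rule ccontr)
      assume "x e \<noteq> 0"
      moreover have "e \<notin> ?F" using e f by (auto simp: star_def)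
      ultimately have "x e = 1" using integral_edge_cases[OF fin x] by blast
      moreover have "x e + x f = sum x {e, f}" using e by auto
      moreover have "sum x {e, f} \<le> sum x (star G v)"
        using e fG finite_star[OF G] x0 by (intro sum_mono2) auto
      ultimately show False using x0(3)[of v] bounds(1)[OF fG(2)] by auto
    qed
    have "?z e = 0" if e: "e \<in> star G v - {f}" for e
    proof -
      have "e \<notin> ?F" using e f by (auto simp: star_def)
      then show ?thesis using z_off zero[OF e] by simp
    qed
    then have "sum ?z (star G v) = ?z f"
      using fG finite_star[OF G, of v] by (simp add: sum.remove[of _ f])
    then show ?thesis using z_le by simp
  qed
  moreover have "?z e = 0" if "e \<notin> G" for e
    using z_off[of e] x0(2)[OF that] that FG by auto
  ultimately have "frac_matching B I G ?z"
    using z_nonneg frac_matching_iff_star[OF fin] by blast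
  then show ?thesis using that pos by blast
qed

text \<open>The feasible step lengths form a compact set, since each constraint is closed and
  depends continuously on \<open>s\<close>. The maximum is therefore attained, and
  \<open>shift_feasible\<close> makes it positive.\<close>

lemma largest_shift_exists:
  assumes fin: "finite B" "finite I" "G \<subseteq> B \<times> I" and x: "frac_matching B I G x"
    and bal: "balanced (frac_edges G x) P N"
  obtains t where "largest_shift B I G x P N t"
proof -
  let ?S = "{s. frac_matching B I G (shift x P N s)}"
  obtain \<epsilon> where \<epsilon>: "\<epsilon> > 0" "\<epsilon> \<in> ?S" using shift_feasible[OF fin x bal] by auto
  obtain e where e: "e \<in> P \<union> N" "P \<inter> N = {}" using bal by (auto simp: balanced_def)
  \<comment> \<open>One shifted edge suffices for boundedness: its value is \<open>x e + s\<close>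
    or \<open>x e - s\<close> and has to stay in the unit interval.\<close>
  have "\<bar>s\<bar> \<le> 1 + \<bar>x e\<bar>" if "s \<in> ?S" for s
  proof -
    have "0 \<le> shift x P N s e" "shift x P N s e \<le> 1"
      using that frac_matching_le_1[OF fin] frac_matching_nonneg by blast+
    then show ?thesis using e by (auto simp: shift_def split: if_splits)
  qed
  then have "bounded ?S" by (auto simp: bounded_iff intro!: exI[of _ "1 + \<bar>x e\<bar>"])
  have cont: "continuous_on UNIV (\<lambda>s. shift x P N s e)" for e
    unfolding shift_def by (cases "e \<in> P"; cases "e \<in> N") (auto intro!: continuous_intros)
  have "closed {s. \<forall>e. 0 \<le> shift x P N s e}"
    by (intro closed_Collect_all closed_Collect_le continuous_on_const cont)
  moreover have "closed {s. \<forall>e. e \<notin> G \<longrightarrow> shift x P N s e = 0}"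
    by (intro closed_Collect_all closed_Collect_imp open_Collect_const closed_Collect_eq
        continuous_on_const cont)
  moreover have "closed {s. \<forall>v. sum (shift x P N s) (star G v) \<le> 1}"
    by (intro closed_Collect_all closed_Collect_le continuous_on_const continuous_on_sum cont)
  ultimately have "closed ?S"
    unfolding frac_matching_iff_star[OF fin] by (intro closed_Collect_conj)
  with \<open>bounded ?S\<close> have "compact ?S" by (simp add: compact_eq_bounded_closed)
  then obtain t where "t \<in> ?S" "\<And>s. s \<in> ?S \<Longrightarrow> s \<le> t"
    using compact_attains_sup[of ?S] \<epsilon> by blast
  with \<epsilon> have "largest_shift B I G x P N t" by (force simp: largest_shift_def)
  then show ?thesis using that by blast
qed

text \<open>This provides the termination measure. Integral edges are not touched, so the set cannot
  grow; if it stayed the same, the balanced pair would admit a further step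
  \<open>\<epsilon>\<close> from the shifted point, contradicting the maximality of
  \<open>t\<close>.\<close>

lemma largest_shift_frac_edges:
  assumes fin: "finite B" "finite I" "G \<subseteq> B \<times> I" and x: "frac_matching B I G x"
    and bal: "balanced (frac_edges G x) P N" and t: "largest_shift B I G x P N t"
  shows "frac_edges G (shift x P N t) \<subset> frac_edges G x"
proof -
  let ?z = "shift x P N t"
  have z: "frac_matching B I G ?z" using t by (auto simp: largest_shift_def)
  have "?z e = x e" if "e \<in> G - frac_edges G x" for e
    using that bal by (auto simp: shift_def balanced_def)
  then have sub: "frac_edges G ?z \<subseteq> frac_edges G x" by (auto simp: frac_edges_def)
  have "frac_edges G ?z \<noteq> frac_edges G x"
  proof
    assume "frac_edges G ?z = frac_edges G x"
    then obtain \<epsilon> where \<epsilon>: "\<epsilon> > 0" "frac_matching B I G (shift ?z P N \<epsilon>)"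
      using shift_feasible[OF fin z] bal by metis
    have "shift ?z P N \<epsilon> = shift x P N (t + \<epsilon>)" by (auto simp: shift_def fun_eq_iff)
    then show False using \<epsilon> t by (fastforce simp: largest_shift_def)
  qed
  with sub show ?thesis by blast
qed

subsection \<open>Cycles and maximal paths\<close>

lemma sum_alternating_telescope:
  fixes f :: "nat \<Rightarrow> int"
  shows "(\<Sum>k<n. (-1) ^ k * (f k + f (Suc k))) = f 0 - (-1) ^ n * f n"
  by (induction n) (auto simp: algebra_simps)

lemma joins_commute: "joins e a b \<longleftrightarrow> joins e b a"
  by (auto simp: joins_def)

lemma joins_ends: "joins e a b \<Longrightarrow> joins e c d \<Longrightarrow> a = c \<and> b = d \<or> a = d \<and> b = c"
  by (auto simp: joins_def)

lemma joins_unique: "joins e a b \<Longrightarrow> joins f a b \<Longrightarrow> e = f"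
  by (auto simp: joins_def prod_eq_iff)

lemma joins_isl: "joins e a b \<Longrightarrow> isl a \<noteq> isl b"
  by (auto simp: joins_def)

lemma joins_incident: "joins e a b \<Longrightarrow> (v = Inl (fst e) \<or> v = Inr (snd e)) \<longleftrightarrow> v = a \<or> v = b"
  by (auto simp: joins_def)

lemma card_star_nth:
  assumes "distinct es"
  shows "int (card (star {es ! k |k. k < length es \<and> Q k} v)) =
    (\<Sum>k<length es. of_bool (Q k \<and> (v = Inl (fst (es ! k)) \<or> v = Inr (snd (es ! k)))))"
proof -
  let ?K = "{k \<in> {..<length es}. Q k \<and> (v = Inl (fst (es ! k)) \<or> v = Inr (snd (es ! k)))}"
  have "star {es ! k |k. k < length es \<and> Q k} v = (!) es ` ?K"
    by (auto simp: star_def)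
  moreover have "inj_on ((!) es) ?K"
    using assms by (auto simp: inj_on_def nth_eq_iff_index_eq)
  ultimately have "card (star {es ! k |k. k < length es \<and> Q k} v) = card ?K"
    by (simp add: card_image)
  then show ?thesis by (simp add: of_bool_def sum.If_cases Int_def)
qed

text \<open>With signs alternating along the walk, every inner visit to \<open>v\<close> is counted
  once with each sign, so the sum telescopes to its two ends. Indexing the vertices by a function
  \<open>u\<close> covers open walks and closed ones, where \<open>u\<close> wraps around.\<close>

lemma walk_star_diff:
  assumes "distinct es" "\<And>k. k < length es \<Longrightarrow> joins (es ! k) (u k) (u (Suc k))"
  shows "int (card (star {es ! k |k. k < length es \<and> even k} v))
       - int (card (star {es ! k |k. k < length es \<and> odd k} v))
       = of_bool (u 0 = v) - (-1) ^ length es * of_bool (u (length es) = v)"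
proof -
  let ?inc = "\<lambda>k. v = Inl (fst (es ! k)) \<or> v = Inr (snd (es ! k))"
  \<comment> \<open>The ends of an edge lie on different sides, so at most one of them equals
    \<open>v\<close> and the indicators add up.\<close>
  have inc: "of_bool (?inc k) = of_bool (u k = v) + (of_bool (u (Suc k) = v) :: int)"
    if "k < length es" for k
    using joins_incident[OF assms(2)[OF that], of v] joins_isl[OF assms(2)[OF that]] by auto
  have "int (card (star {es ! k |k. k < length es \<and> even k} v))
       - int (card (star {es ! k |k. k < length es \<and> odd k} v))
       = (\<Sum>k<length es. (-1) ^ k * of_bool (?inc k))"
    unfolding card_star_nth[OF assms(1)] sum_subtractf[symmetric] by (intro sum.cong) auto
  also have "\<dots> = (\<Sum>k<length es. (-1) ^ k * (of_bool (u k = v) + of_bool (u (Suc k) = v)))"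
    using inc by (intro sum.cong) auto
  also have "\<dots> = of_bool (u 0 = v) - (-1) ^ length es * of_bool (u (length es) = v)"
    by (rule sum_alternating_telescope)
  finally show ?thesis .
qed

text \<open>An edge determines its pair of ends, so a repeated edge would force a repeated
  vertex.\<close>

lemma path_edges_distinct:
  assumes "is_path F vs es"
  shows "distinct es"
proof (rule ccontr)
  assume "\<not> distinct es"
  then obtain j k where jk: "j < k" "k < length es" "es ! j = es ! k"
    unfolding distinct_conv_nth by (metis linorder_neqE_nat)
  then have "joins (es ! k) (vs ! j) (vs ! Suc j)" "joins (es ! k) (vs ! k) (vs ! Suc k)"
    using assms unfolding is_path_def by (metis order.strict_trans)+
  from joins_ends[OF this] have "vs ! j = vs ! k \<or> vs ! j = vs ! Suc k" by blast
  then show False using assms jk by (auto simp: is_path_def nth_eq_iff_index_eq)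
qed

lemma cycle_edges_distinct:
  assumes "is_cycle F vs es"
  shows "distinct es"
proof (rule ccontr)
  let ?n = "length es"
  assume "\<not> distinct es"
  then obtain j k where jk: "j < k" "k < ?n" "es ! j = es ! k"
    unfolding distinct_conv_nth by (metis linorder_neqE_nat)
  have vs: "3 \<le> ?n" "length vs = ?n" "distinct vs" using assms by (auto simp: is_cycle_def)
  have "joins (es ! k) (vs ! j) (vs ! (Suc j mod ?n))" "joins (es ! k) (vs ! k) (vs ! (Suc k mod ?n))"
    using assms jk unfolding is_cycle_def by (metis order.strict_trans)+
  from joins_ends[OF this]
  have "vs ! j = vs ! k \<or> vs ! j = vs ! (Suc k mod ?n) \<and> vs ! (Suc j mod ?n) = vs ! k" by blast
  moreover have "Suc k mod ?n < ?n" "Suc j mod ?n = Suc j" using jk by (auto intro: mod_less_divisor)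
  ultimately have "j = Suc k mod ?n" "Suc j = k"
    using vs jk by (auto simp: nth_eq_iff_index_eq)
  \<comment> \<open>The two positions would be neighbours in both cyclic directions, which happens
    only for length 2; the bound \<open>3 \<le> length es\<close> excludes this.\<close>
  then show False using vs(1) jk by (cases "Suc k = ?n") auto
qed

text \<open>Maximality puts every edge at an end point onto the path, and distinctness of the
  vertices then leaves only the first or the last edge.\<close>

lemma maximal_path_end_degree:
  assumes "is_maximal_path F vs es" "v = hd vs \<or> v = last vs"
  shows "card (star F v) \<le> 1"
proof -
  have p: "es \<noteq> []" "length vs = Suc (length es)" "distinct vs"
      "\<And>k. k < length es \<Longrightarrow> joins (es ! k) (vs ! k) (vs ! Suc k)"
    using assms(1) by (auto simp: is_maximal_path_def is_path_def)
  have "vs \<noteq> []" using p(2) by auto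
  then have ends: "hd vs = vs ! 0" "last vs = vs ! length es"
    using p(2) by (simp_all add: hd_conv_nth last_conv_nth)
  define f where "f = (if v = hd vs then es ! 0 else es ! (length es - 1))"
  have "star F v \<subseteq> {f}"
  proof
    fix e assume e: "e \<in> star F v"
    then obtain w where "joins e v w"
      by (cases "v = Inl (fst e)") (auto simp: star_def joins_def)
    then have "e \<in> set es" using assms e by (auto simp: is_maximal_path_def star_def)
    then obtain k where k: "k < length es" "e = es ! k" by (auto simp: in_set_conv_nth)
    have "v = vs ! k \<or> v = vs ! Suc k"
      using joins_incident[OF p(4)[OF k(1)], of v] e k by (auto simp: star_def)
    then have "k = 0 \<and> v = hd vs \<or> k = length es - 1 \<and> v \<noteq> hd vs"
      using assms(2) p k ends by (auto simp: nth_eq_iff_index_eq)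
    then show "e \<in> {f}" using k by (auto simp: f_def)
  qed
  then show ?thesis using card_mono[of "{f}"] by simp
qed

text \<open>The two boundary terms of \<open>walk_star_diff\<close> cancel on a cycle. On a path
  they vanish away from the end points, and the end points have degree at most one.\<close>

lemma alternating_split_balanced:
  assumes "alternating_split F P N"
  shows "balanced F P N"
proof -
  obtain vs es where split: "is_cycle F vs es \<or> is_maximal_path F vs es"
    and PN: "P = {es ! k |k. k < length es \<and> even k}" "N = {es ! k |k. k < length es \<and> odd k}"
    using assms by (auto simp: alternating_split_def)
  have dist: "distinct es"
    using split path_edges_distinct cycle_edges_distinct by (auto simp: is_maximal_path_def)
  have ne: "0 < length es" and sub: "set es \<subseteq> F"
    using split by (auto simp: is_maximal_path_def is_path_def is_cycle_def)
  have "card (star P v) = card (star N v) \<or> card (star F v) \<le> 1" for v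
    using split
  proof
    assume c: "is_cycle F vs es"
    define u where "u k = vs ! (k mod length es)" for k
    have u: "joins (es ! k) (u k) (u (Suc k))" if "k < length es" for k
      using c that by (auto simp: is_cycle_def u_def)
    \<comment> \<open>Sides alternate along the walk, so returning to the start forces even length;
      only then does the sign at the closing vertex match.\<close>
    have "isl (u k) = (isl (u 0) = even k)" if "k \<le> length es" for k
      using that by (induction k) (use joins_isl[OF u] in force)+
    from this[of "length es"] have "even (length es)" by (auto simp: u_def)
    then show ?thesis
      using walk_star_diff[OF dist u, of v] by (auto simp: PN u_def)
  next
    assume p: "is_maximal_path F vs es"
    then have u: "joins (es ! k) (vs ! k) (vs ! Suc k)" if "k < length es" for k
      using that by (auto simp: is_maximal_path_def is_path_def)
    have "length vs = Suc (length es)" using p by (auto simp: is_maximal_path_def is_path_def)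
    then have "hd vs = vs ! 0" "last vs = vs ! length es"
      by (auto simp: hd_conv_nth last_conv_nth simp flip: length_0_conv)
    then show ?thesis
      using maximal_path_end_degree[OF p, of v] walk_star_diff[of es "(!) vs" v, OF dist u]
      by (cases "vs ! 0 = v \<or> vs ! length es = v") (auto simp: PN)
  qed
  moreover have "P \<inter> N = {}" using dist by (auto simp: PN nth_eq_iff_index_eq)
  moreover have "es ! 0 \<in> P" using ne by (auto simp: PN)
  moreover have "P \<union> N \<subseteq> F" using sub by (auto simp: PN)
  ultimately show ?thesis unfolding balanced_def by blast
qed

section \<open>Existence of a cycle or a maximal path\<close>

lemma is_path_rev: 
  assumes "is_path F vs es"
  shows "is_path F (rev vs) (rev es)"
proof -
  have "joins (rev es ! k) (rev vs ! k) (rev vs ! Suc k)" if "k < length es" for k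
  proof -
    have "joins (es ! (length es - Suc k)) (vs ! (length es - Suc k)) (vs ! Suc (length es - Suc k))"
      using assms that by (auto simp: is_path_def)
    moreover have "Suc (length es - Suc k) = length es - k" using that by auto
    ultimately show ?thesis
      using assms that by (auto simp: is_path_def rev_nth joins_commute)
  qed
  then show ?thesis using assms by (auto simp: is_path_def)
qed

text \<open>Prepending \<open>e\<close> would lengthen the path if \<open>w\<close> were new. Hence
  \<open>w\<close> lies on the path, and \<open>e\<close> closes the initial segment up to
  \<open>w\<close> into a cycle.\<close>

lemma longest_path_closes:
  assumes path: "is_path F vs es"
    and longest: "\<And>vs' es'. is_path F vs' es' \<Longrightarrow> length es' \<le> length es"
    and e: "e \<in> F - set es" "joins e (hd vs) w"
  shows "\<exists>vs' es'. is_cycle F vs' es'"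
proof -
  have p: "es \<noteq> []" "length vs = Suc (length es)" "distinct vs" "set es \<subseteq> F"
      "\<And>k. k < length es \<Longrightarrow> joins (es ! k) (vs ! k) (vs ! Suc k)"
    using path by (auto simp: is_path_def)
  have hd: "hd vs = vs ! 0" using p(2) by (intro hd_conv_nth) auto
  have "w \<in> set vs"
  proof (rule ccontr)
    assume "w \<notin> set vs"
    moreover have "joins ((e # es) ! k) ((w # vs) ! k) ((w # vs) ! Suc k)" if "k < Suc (length es)" for k
      using that e p(5) hd joins_commute[of e w] by (cases k) auto
    ultimately have "is_path F (w # vs) (e # es)" using p e by (auto simp: is_path_def)
    from longest[OF this] show False by simp
  qed
  then obtain j where j: "j < length vs" "w = vs ! j" by (auto simp: in_set_conv_nth)
  \<comment> \<open>Bipartiteness rules out position 0, and position 1 would make \<open>e\<close>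
    the first edge of the path. So the cycle has \<open>j + 1 \<ge> 3\<close> edges.\<close>
  have "j \<noteq> 0" using e hd j joins_isl by metis
  moreover have "j \<noteq> 1"
  proof
    assume "j = 1"
    moreover have "joins (es ! 0) (vs ! 0) (vs ! 1)" using p(1,5) by auto
    ultimately have "e = es ! 0" using e hd j joins_unique by metis
    then show False using e p(1) by auto
  qed
  ultimately have j2: "2 \<le> j" "j \<le> length es" using j p by auto
  \<comment> \<open>The closing edge \<open>e\<close> has index \<open>j\<close>, where the
    successor index wraps to 0.\<close>
  have "joins ((take j es @ [e]) ! k) (take (Suc j) vs ! k) (take (Suc j) vs ! (Suc k mod Suc j))"
    if "k < Suc j" for k
    using that e(2) p j j2 hd joins_commute[of e] by (cases "k = j") (auto simp: nth_append)
  then have "is_cycle F (take (Suc j) vs) (take j es @ [e])"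
    using j2 j p e set_take_subset[of j es] by (auto simp: is_cycle_def min.absorb2)
  then show ?thesis by blast
qed

text \<open>Path edges are distinct, so path lengths are bounded by \<open>card F\<close> and a
  longest path exists. Either it is maximal, or an additional edge at one end closes a cycle; the
  far end is handled by reversal.\<close>

lemma alternating_split_exists:
  assumes "finite F" "F \<noteq> {}"
  obtains P N where "alternating_split F P N"
proof -
  obtain e where e: "e \<in> F" using assms by auto
  \<comment> \<open>A single edge serves as the initial path from which the maximum is known to
    exist.\<close>
  define z where "z = ([Inl (fst e), Inr (snd e)], [e])"
  have "is_path F (fst z) (snd z)" using e by (auto simp: z_def is_path_def joins_def)
  moreover have "length es \<le> card F" if "is_path F vs es" for vs es
    using that path_edges_distinct[OF that] card_mono[OF assms(1), of "set es"]
    by (auto simp: is_path_def distinct_card)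
  ultimately have "\<exists>z. is_path F (fst z) (snd z) \<and>
      (\<forall>z'. is_path F (fst z') (snd z') \<longrightarrow> length (snd z') \<le> length (snd z))"
    using ex_has_greatest_nat[of "\<lambda>z. is_path F (fst z) (snd z)" z "\<lambda>z. length (snd z)" "Suc (card F)"]
    by (simp add: less_Suc_eq_le)
  then obtain vs es where p: "is_path F vs es"
    and longest: "\<And>vs' es'. is_path F vs' es' \<Longrightarrow> length es' \<le> length es"
    by auto
  have "\<exists>vs es. is_cycle F vs es \<or> is_maximal_path F vs es"
  proof (cases "is_maximal_path F vs es")
    case False
    then obtain e w where e: "e \<in> F - set es" "joins e (hd vs) w \<or> joins e (last vs) w"
      using p by (auto simp: is_maximal_path_def)
    from e(2) have "\<exists>vs es. is_cycle F vs es"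
    proof
      assume "joins e (hd vs) w"
      with e(1) longest show ?thesis
        by (intro longest_path_closes[OF p, of e w]) auto
    next
      assume "joins e (last vs) w"
      then have "joins e (hd (rev vs)) w" by (simp add: hd_rev)
      with e(1) longest show ?thesis
        by (intro longest_path_closes[OF is_path_rev[OF p], of e w]) auto
    qed
    then show ?thesis by blast
  qed blast
  then show ?thesis using that unfolding alternating_split_def by blast
qed

section \<open>Dependent rounding: existence of runs, matchings and marginals\<close>

lemma dep_rounding_exists:
  assumes fin: "finite B" "finite I" "G \<subseteq> B \<times> I" and "frac_matching B I G x"
  shows "\<exists>p. dep_rounding B I G x p"
  using assms(4)
proof (induction "card (frac_edges G x)" arbitrary: x rule: less_induct)
  case less
  have finF: "finite (frac_edges G x)"
    using fin finite_subset[of "frac_edges G x" "B \<times> I"] by (auto simp: frac_edges_def)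
  show ?case
  proof (cases "frac_edges G x = {}")
    case True
    then show ?thesis using dep_rounding.integral by blast
  next
    case False
    then obtain P N where split: "alternating_split (frac_edges G x) P N"
      using alternating_split_exists finF by blast
    note bal = alternating_split_balanced[OF split]
    \<comment> \<open>Stated for an arbitrary balanced pair, because each round needs a recursive
      run after both shift directions.\<close>
    have round: "\<exists>t p. largest_shift B I G x S T t \<and> dep_rounding B I G (shift x S T t) p"
      if "balanced (frac_edges G x) S T" for S T
    proof -
      obtain t where t: "largest_shift B I G x S T t"
        using largest_shift_exists[OF fin less.prems \<open>balanced _ S T\<close>] .
      moreover have "card (frac_edges G (shift x S T t)) < card (frac_edges G x)"
        using largest_shift_frac_edges[OF fin less.prems that t] finF by (rule psubset_card_mono[rotated])
      ultimately show ?thesis using less.hyps by (meson largest_shift_def)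
    qed
    show ?thesis
      using round[OF bal] round[OF balanced_sym[OF bal]] dep_rounding.step[OF split] by metis
  qed
qed

text \<open>Rule induction along the run. A feasible integral point is the indicator of a matching,
  and each round leaves the mean of every edge value unchanged because the probabilities weight the
  two opposite shifts inversely to their lengths.\<close>

lemma dep_rounding_matching_marginal:
  assumes fin: "finite B" "finite I" "G \<subseteq> B \<times> I"
    and "dep_rounding B I G x p" "frac_matching B I G x"
  shows "(\<forall>M\<in>set_pmf p. matching G M) \<and>
    (\<forall>e. measure_pmf.expectation p (\<lambda>M. of_bool (e \<in> M)) = x e)"
  using assms(4,5)
proof (induction rule: dep_rounding.induct)
  case (integral x)
  let ?M = "{e \<in> G. x e = 1}"
  have "fst e \<noteq> fst f \<and> snd e \<noteq> snd f" if ef: "e \<in> ?M" "f \<in> ?M" "e \<noteq> f" for e f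
  proof (rule ccontr)
    assume "\<not> ?thesis"
    \<comment> \<open>A shared vertex would carry two edges of value 1 and so have degree at least
      2.\<close>
    then obtain v where v: "{e, f} \<subseteq> star G v"
      using ef by (cases "fst e = fst f") (auto simp: star_def)
    have "sum x {e, f} \<le> sum x (star G v)"
      using v finite_subset[OF fin(3)] fin frac_matching_nonneg[OF integral.prems]
      by (intro sum_mono2 finite_star) auto
    moreover have "sum x (star G v) \<le> 1"
      using integral.prems frac_matching_iff_star[OF fin] by blast
    ultimately show False using ef by auto
  qed
  then have "matching G ?M" unfolding matching_def by blast
  moreover have "of_bool (e \<in> ?M) = x e" for e
    using integral_edge_cases[OF fin integral.prems, of e] integral.hyps
      frac_matching_outside[OF integral.prems, of e] by auto
  ultimately show ?case by simp
next
  case (step x M' M'' \<alpha> \<beta> p q)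
  have pos: "0 < \<alpha>" "0 < \<beta>" and "frac_matching B I G (shift x M' M'' \<alpha>)"
      "frac_matching B I G (shift x M'' M' \<beta>)"
    using step.hyps by (auto simp: largest_shift_def)
  note IH = step.IH(1)[OF this(3)] step.IH(2)[OF this(4)]
  have "finite G" using fin finite_subset by blast
  \<comment> \<open>Every output is a subset of the finite set \<open>G\<close>; finite support lets
    the expectation over the coin be expanded.\<close>
  then have finite: "finite (set_pmf p)" "finite (set_pmf q)"
    using IH by (auto simp: matching_def intro!: finite_subset[of _ "Pow G"])
  let ?c = "\<beta> / (\<alpha> + \<beta>)"
  have c: "0 \<le> ?c" "?c \<le> 1" using pos by auto
  have "measure_pmf.expectation (bernoulli_pmf ?c \<bind> (\<lambda>c. if c then p else q)) (\<lambda>M. of_bool (e \<in> M)) = x e"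
    for e
  proof -
    have "measure_pmf.expectation (bernoulli_pmf ?c \<bind> (\<lambda>c. if c then p else q)) (\<lambda>M. of_bool (e \<in> M))
      = ?c * shift x M' M'' \<alpha> e + (1 - ?c) * shift x M'' M' \<beta> e"
      using finite IH c
      by (subst pmf_expectation_bind[of "{True, False}"]) (auto simp del: split_paired_All)
    also have "\<dots> = x e"
    proof -
      \<comment> \<open>The sign with which \<open>e\<close> takes part in the shift: 1 on
        \<open>M'\<close>, -1 on \<open>M''\<close>, 0 off both. The expected change is then
        \<open>d\<close> times a factor that vanishes.\<close>
      define d where "d = of_bool (e \<in> M') - (of_bool (e \<in> M'') :: real)"
      have "shift x M' M'' \<alpha> e = x e + \<alpha> * d" "shift x M'' M' \<beta> e = x e - \<beta> * d"
        by (auto simp: shift_def d_def)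
      moreover have "?c * (x e + \<alpha> * d) + (1 - ?c) * (x e - \<beta> * d) = x e + d * (?c * (\<alpha> + \<beta>) - \<beta>)"
        by (simp only: algebra_simps)
      moreover have "?c * (\<alpha> + \<beta>) = \<beta>" using pos by simp
      ultimately show ?thesis by simp
    qed
    finally show ?thesis .
  qed
  moreover have "matching G M" if M: "M \<in> set_pmf (bernoulli_pmf ?c \<bind> (\<lambda>c. if c then p else q))" for M
  proof -
    obtain c where "M \<in> set_pmf (if c then p else q)"
      using M unfolding set_bind_pmf by (elim UN_E)
    then show ?thesis
      using IH(1)[THEN conjunct1] IH(2)[THEN conjunct1] by (cases c) simp_all
  qed
  ultimately show ?case by (intro conjI ballI allI)
qed

subsection \<open>The two-stage guarantee\<close>

lemma pmf_expectation_cong: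
  fixes f g :: "'a \<Rightarrow> real"
  assumes "\<And>x. x \<in> set_pmf p \<Longrightarrow> f x = g x"
  shows "measure_pmf.expectation p f = measure_pmf.expectation p g"
  using assms by (intro integral_cong_AE) (auto simp: AE_measure_pmf_iff)

lemma pmf_expectation_bind_finite:
  fixes h :: "'b \<Rightarrow> real"
  assumes "finite (set_pmf p)" "\<And>x. x \<in> set_pmf p \<Longrightarrow> finite (set_pmf (f x))"
  shows "measure_pmf.expectation (bind_pmf p f) h =
    measure_pmf.expectation p (\<lambda>x. measure_pmf.expectation (f x) h)"
  using assms
  by (simp add: pmf_expectation_bind[of "set_pmf p"] integral_measure_pmf[of "set_pmf p"])

section \<open>Matchings through their edge indicators\<close>

lemma matching_imp_frac_matching:
  assumes "finite B" "finite I" "G \<subseteq> B \<times> I" "matching G M"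
  shows "frac_matching B I G (\<lambda>e. of_bool (e \<in> M))"
proof -
  have "sum (\<lambda>e. of_bool (e \<in> M) :: real) (star G v) \<le> 1" for v
  proof -
    have "finite G" using assms finite_subset by blast
    have "star M v \<subseteq> {e} \<or> star M v = {}" if "e \<in> star M v" for e
      using that assms(4) unfolding matching_def star_def by fastforce
    then obtain e where "star M v \<subseteq> {e}" by blast
    then have "card (star M v) \<le> 1" using card_mono[of "{e}"] by simp
    moreover have "star G v \<inter> {e. e \<in> M} = star M v"
      using assms(4) by (auto simp: matching_def star_def)
    ultimately show ?thesis
      using finite_star[OF \<open>finite G\<close>, of v] by (simp add: of_bool_def sum.If_cases)
  qed
  moreover have "of_bool (e \<in> M) = (0 :: real)" if "e \<notin> G" for e
    using assms(4) that by (auto simp: matching_def)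
  ultimately show ?thesis
    unfolding frac_matching_iff_star[OF assms(1-3)] by (intro conjI allI impI) simp_all
qed

lemma max_matching_size_attained:
  assumes "finite G"
  obtains M where "matching G M" "card M = max_matching_size G"
proof -
  have "{M. matching G M} \<subseteq> Pow G" by (auto simp: matching_def)
  then have "finite {M. matching G M}" using assms finite_subset by blast
  moreover have "matching G {}" by (auto simp: matching_def)
  ultimately have "Max (card ` {M. matching G M}) \<in> card ` {M. matching G M}"
    by (intro Max_in) auto
  then show ?thesis using that by (auto simp: max_matching_size_def)
qed

lemma card_eq_sum_of_bool:
  assumes "finite B" "finite I" "M \<subseteq> B \<times> I"
  shows "real (card M) = (\<Sum>i\<in>I. \<Sum>b\<in>B. of_bool ((b, i) \<in> M))"
proof -
  have "(\<Sum>i\<in>I. \<Sum>b\<in>B. of_bool ((b, i) \<in> M)) = (\<Sum>e\<in>B \<times> I. of_bool (e \<in> M) :: real)"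
    by (subst sum.swap) (simp add: sum.cartesian_product case_prod_unfold)
  also have "\<dots> = card ((B \<times> I) \<inter> M)"
    using assms by (simp add: of_bool_def sum.If_cases)
  finally show ?thesis using assms(3) by (simp add: inf.absorb2)
qed

text \<open>Edges of different stages cannot share an online node because the batches are disjoint,
  and precedence of the first stage removes conflicts at offline nodes.\<close>

lemma matching_combine_stages:
  assumes "B1 \<inter> B2 = {}" "E \<subseteq> B1 \<times> I" "E' \<subseteq> B2 \<times> I" "matching E M1" "matching E' M2"
  shows "matching (E \<union> E') (combine_stages M1 M2)"
proof -
  have "fst e \<noteq> fst f" if "e \<in> M1" "f \<in> M2" for e f
    using that assms by (fastforce simp: matching_def)
  then have "fst e \<noteq> fst f \<and> snd e \<noteq> snd f"
    if "e \<in> combine_stages M1 M2" "f \<in> combine_stages M1 M2" "e \<noteq> f" for e f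
    using that assms(4,5) unfolding matching_def combine_stages_def
    by (elim UnE CollectE conjE) (metis imageI)+
  moreover have "combine_stages M1 M2 \<subseteq> E \<union> E'"
    using assms(4,5) by (auto simp: matching_def combine_stages_def)
  ultimately show ?thesis unfolding matching_def by blast
qed

lemma matching_degree_Inr:
  assumes "finite B" "G \<subseteq> B \<times> I" "matching G M"
  shows "(\<Sum>b\<in>B. of_bool ((b, i) \<in> M) :: real) = of_bool (i \<in> snd ` M)"
proof (cases "i \<in> snd ` M")
  case True
  then obtain a where a: "(a, i) \<in> M" by auto
  then have "a \<in> B" using assms(2,3) by (auto simp: matching_def)
  have uniq: "\<forall>e\<in>M. \<forall>f\<in>M. e \<noteq> f \<longrightarrow> fst e \<noteq> fst f \<and> snd e \<noteq> snd f"
    using assms(3) unfolding matching_def by (rule conjunct2)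
  have "(b, i) \<in> M \<longleftrightarrow> b = a" for b
    using uniq[rule_format, of "(b, i)" "(a, i)"] a by auto
  then have "(\<Sum>b\<in>B. of_bool ((b, i) \<in> M) :: real) = (\<Sum>b\<in>B. of_bool (b = a))"
    by (simp only:)
  then show ?thesis using True \<open>a \<in> B\<close> assms(1) by (simp add: of_bool_def)
next
  case False
  then have "(b, i) \<notin> M" for b using imageI[of "(b, i)" M snd] by auto
  with False show ?thesis by simp
qed

text \<open>By \<open>matching_degree_Inr\<close>, one minus the degree of \<open>i\<close> in
  \<open>M1\<close> is the indicator that \<open>i\<close> is still free. This turns precedence into
  a product of a first-stage and a second-stage factor, to which independence applies.\<close>

lemma card_combine_stages:
  assumes "finite B1" "finite B2" "finite I" "B1 \<inter> B2 = {}" "E \<subseteq> B1 \<times> I" "E' \<subseteq> B2 \<times> I"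
    and M1: "matching E M1" and "M2 \<subseteq> E'"
  shows "real (card (combine_stages M1 M2)) =
    (\<Sum>i\<in>I. (\<Sum>a\<in>B1. of_bool ((a, i) \<in> M1)) +
      (1 - (\<Sum>a\<in>B1. of_bool ((a, i) \<in> M1))) * (\<Sum>b\<in>B2. of_bool ((b, i) \<in> M2)))"
proof -
  let ?R = "{e \<in> M2. snd e \<notin> snd ` M1}"
  have sub: "M1 \<subseteq> B1 \<times> I" "?R \<subseteq> B2 \<times> I" using assms by (auto simp: matching_def)
  have "M1 \<inter> ?R = {}" using sub assms(4) by auto
  moreover have "finite M1" "finite ?R"
    using sub assms(1-3) by (meson finite_SigmaI finite_subset)+
  ultimately have "real (card (combine_stages M1 M2)) = card M1 + card ?R"
    unfolding combine_stages_def by (subst card_Un_disjoint) auto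
  also have "\<dots> = (\<Sum>i\<in>I. (\<Sum>a\<in>B1. of_bool ((a, i) \<in> M1)) + (\<Sum>b\<in>B2. of_bool ((b, i) \<in> ?R)))"
    using card_eq_sum_of_bool[OF assms(1,3) sub(1)] card_eq_sum_of_bool[OF assms(2,3) sub(2)]
    by (simp add: sum.distrib)
  also have "\<dots> = (\<Sum>i\<in>I. (\<Sum>a\<in>B1. of_bool ((a, i) \<in> M1)) +
      (1 - (\<Sum>a\<in>B1. of_bool ((a, i) \<in> M1))) * (\<Sum>b\<in>B2. of_bool ((b, i) \<in> M2)))"
    unfolding matching_degree_Inr[OF assms(1,5) M1] by (intro sum.cong) auto
  finally show ?thesis .
qed

section \<open>The offline optimum as an LP value\<close>

lemma opt_off_as_lp_value:
  assumes fin: "finite I" "finite B1" "finite B2" and disj: "B1 \<inter> B2 = {}"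
    and D: "finite (set_pmf D)"
    and E: "E \<subseteq> B1 \<times> I" and E2: "\<And>\<theta>. \<theta> \<in> set_pmf D \<Longrightarrow> E2 \<theta> \<subseteq> B2 \<times> I"
  obtains x y where "lp_feasible I B1 B2 E E2 D x y" "opt_off E E2 D = lp_value I B1 B2 D x y"
proof -
  have sub: "E \<union> E2 \<theta> \<subseteq> (B1 \<union> B2) \<times> I" if "\<theta> \<in> set_pmf D" for \<theta>
    using E E2[OF that] by auto
  have "\<exists>M. matching (E \<union> E2 \<theta>) M \<and> card M = max_matching_size (E \<union> E2 \<theta>)" if "\<theta> \<in> set_pmf D" for \<theta>
    using max_matching_size_attained[of "E \<union> E2 \<theta>"] finite_subset[OF sub[OF that]] fin by blast
  then obtain M where M: "\<And>\<theta>. \<theta> \<in> set_pmf D \<Longrightarrow> matching (E \<union> E2 \<theta>) (M \<theta>)"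
    and card: "\<And>\<theta>. \<theta> \<in> set_pmf D \<Longrightarrow> card (M \<theta>) = max_matching_size (E \<union> E2 \<theta>)"
    by metis
  \<comment> \<open>First-stage variables may not depend on the scenario, so the first-stage part of
    the maximum matching \<open>M \<theta>\<close> is averaged; \<open>y\<close> may follow the
    scenario and keeps the second-stage part as it is.\<close>
  define x where "x e = measure_pmf.expectation D (\<lambda>\<theta>. of_bool (e \<in> M \<theta> \<inter> E) :: real)" for e
  define y where "y \<theta> e = (of_bool (e \<in> M \<theta> \<inter> E2 \<theta>) :: real)" for \<theta> e
  note int = integrable_measure_pmf_finite[OF D]
  have frac: "frac_matching (B1 \<union> B2) I (E \<union> E2 \<theta>) (\<lambda>e. of_bool (e \<in> M \<theta>))" if "\<theta> \<in> set_pmf D" for \<theta>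
    using matching_imp_frac_matching[OF _ fin(1) sub[OF that] M[OF that]] fin by simp
  \<comment> \<open>Since the batches are disjoint, the online node of an edge of
    \<open>M \<theta>\<close> already tells its stage.\<close>
  have in1: "(a, i) \<in> M \<theta> \<inter> E \<longleftrightarrow> (a, i) \<in> M \<theta>" if "\<theta> \<in> set_pmf D" "a \<in> B1" for \<theta> a i
    using M[OF that(1)] E2[OF that(1)] that(2) disj by (auto simp: matching_def)
  have in2: "(b, i) \<in> M \<theta> \<inter> E2 \<theta> \<longleftrightarrow> (b, i) \<in> M \<theta>" if "\<theta> \<in> set_pmf D" "b \<in> B2" for \<theta> b i
    using M[OF that(1)] E that(2) disj by (auto simp: matching_def)
  have split: "(\<Sum>a\<in>B1. of_bool ((a, i) \<in> M \<theta> \<inter> E)) + (\<Sum>b\<in>B2. y \<theta> (b, i))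
      = (\<Sum>b\<in>B1 \<union> B2. of_bool ((b, i) \<in> M \<theta>) :: real)" if "\<theta> \<in> set_pmf D" for \<theta> i
    using in1[OF that] in2[OF that] fin disj by (subst sum.union_disjoint) (simp_all add: y_def)
  \<comment> \<open>The LP load of \<open>i\<close> is its expected degree in
    \<open>M \<theta>\<close>. This gives the offline constraint and, summed over \<open>i\<close>,
    the objective value.\<close>
  have offline: "(\<Sum>a\<in>B1. x (a, i)) + (\<Sum>b\<in>B2. measure_pmf.expectation D (\<lambda>\<theta>. y \<theta> (b, i)))
      = measure_pmf.expectation D (\<lambda>\<theta>. \<Sum>b\<in>B1 \<union> B2. of_bool ((b, i) \<in> M \<theta>))" for i
  proof -
    have "(\<Sum>a\<in>B1. x (a, i)) + (\<Sum>b\<in>B2. measure_pmf.expectation D (\<lambda>\<theta>. y \<theta> (b, i)))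
      = measure_pmf.expectation D (\<lambda>\<theta>. (\<Sum>a\<in>B1. of_bool ((a, i) \<in> M \<theta> \<inter> E)) + (\<Sum>b\<in>B2. y \<theta> (b, i)))"
      unfolding x_def by (simp only: Bochner_Integration.integral_add Bochner_Integration.integral_sum int)
    also have "\<dots> = measure_pmf.expectation D (\<lambda>\<theta>. \<Sum>b\<in>B1 \<union> B2. of_bool ((b, i) \<in> M \<theta>))"
      by (intro pmf_expectation_cong split)
    finally show ?thesis .
  qed
  have exp_le: "measure_pmf.expectation D f \<le> 1" if "\<And>\<theta>. \<theta> \<in> set_pmf D \<Longrightarrow> f \<theta> \<le> (1::real)" for f
    using that by (intro measure_pmf.integral_le_const int) (auto simp: AE_measure_pmf_iff)
  have "lp_feasible I B1 B2 E E2 D x y"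
    unfolding lp_feasible_def
  proof (intro conjI ballI allI impI)
    fix i assume i: "i \<in> I"
    show "(\<Sum>a\<in>B1. x (a, i)) + (\<Sum>b\<in>B2. measure_pmf.expectation D (\<lambda>\<theta>. y \<theta> (b, i))) \<le> 1"
      unfolding offline using frac i by (intro exp_le) (auto simp: frac_matching_def)
    fix \<theta> assume \<theta>: "\<theta> \<in> set_pmf D"
    have "(\<Sum>b\<in>B2. y \<theta> (b, i)) \<le> (\<Sum>b\<in>B1 \<union> B2. of_bool ((b, i) \<in> M \<theta>))"
      unfolding split[OF \<theta>, symmetric] by (simp add: sum_nonneg)
    also have "\<dots> \<le> 1" using frac[OF \<theta>] i by (auto simp: frac_matching_def)
    finally show "(\<Sum>b\<in>B2. y \<theta> (b, i)) \<le> 1" .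
  next
    fix a assume a: "a \<in> B1"
    have "(\<Sum>i\<in>I. x (a, i)) = measure_pmf.expectation D (\<lambda>\<theta>. \<Sum>i\<in>I. of_bool ((a, i) \<in> M \<theta> \<inter> E))"
      unfolding x_def by (simp only: Bochner_Integration.integral_sum int)
    also have "\<dots> \<le> 1"
    proof (intro exp_le)
      fix \<theta> assume \<theta>: "\<theta> \<in> set_pmf D"
      then show "(\<Sum>i\<in>I. of_bool ((a, i) \<in> M \<theta> \<inter> E)) \<le> (1::real)"
        unfolding in1[OF \<theta> a] using frac[OF \<theta>] a by (auto simp: frac_matching_def)
    qed
    finally show "(\<Sum>i\<in>I. x (a, i)) \<le> 1" .
  next
    fix b \<theta> assume b: "b \<in> B2" and \<theta>: "\<theta> \<in> set_pmf D"
    show "(\<Sum>i\<in>I. y \<theta> (b, i)) \<le> 1"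
      unfolding y_def in2[OF \<theta> b] using frac[OF \<theta>] b by (auto simp: frac_matching_def)
  qed (auto simp: x_def y_def)
  moreover have "opt_off E E2 D = lp_value I B1 B2 D x y"
  proof -
    have "lp_value I B1 B2 D x y =
        (\<Sum>i\<in>I. measure_pmf.expectation D (\<lambda>\<theta>. \<Sum>b\<in>B1 \<union> B2. of_bool ((b, i) \<in> M \<theta>)))"
      by (simp add: lp_value_def flip: offline sum.distrib)
    also have "\<dots> = measure_pmf.expectation D (\<lambda>\<theta>. \<Sum>i\<in>I. \<Sum>b\<in>B1 \<union> B2. of_bool ((b, i) \<in> M \<theta>))"
      by (simp only: Bochner_Integration.integral_sum int)
    also have "\<dots> = opt_off E E2 D"
      unfolding opt_off_def
    proof (intro pmf_expectation_cong)
      fix \<theta> assume \<theta>: "\<theta> \<in> set_pmf D"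
      have "M \<theta> \<subseteq> (B1 \<union> B2) \<times> I" using M[OF \<theta>] sub[OF \<theta>] by (auto simp: matching_def)
      then show "(\<Sum>i\<in>I. \<Sum>b\<in>B1 \<union> B2. of_bool ((b, i) \<in> M \<theta>)) = real (max_matching_size (E \<union> E2 \<theta>))"
        using card_eq_sum_of_bool[of "B1 \<union> B2" I "M \<theta>"] fin card[OF \<theta>] by simp
    qed
    finally show ?thesis by simp
  qed
  ultimately show ?thesis using that by blast
qed

section \<open>Expected size of the rounded solution\<close>

text \<open>The LP bounds the offline load of both stages jointly; dropping the nonnegative
  second-stage share yields the first-stage degree bound.\<close>

lemma lp_feasible_frac_matching:
  assumes feas: "lp_feasible I B1 B2 E E2 D x y"
  shows "frac_matching B1 I E x" "\<theta> \<in> set_pmf D \<Longrightarrow> frac_matching B2 I (E2 \<theta>) (y \<theta>)"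
proof -
  have nonneg: "0 \<le> (\<Sum>b\<in>B2. measure_pmf.expectation D (\<lambda>\<theta>. y \<theta> (b, i)))" for i
    using feas by (intro sum_nonneg integral_nonneg_AE) (simp add: lp_feasible_def AE_measure_pmf_iff)
  have le: "(\<Sum>b\<in>B1. x (b, i)) \<le> 1" if "i \<in> I" for i
  proof -
    have "(\<Sum>b\<in>B1. x (b, i)) + (\<Sum>b\<in>B2. measure_pmf.expectation D (\<lambda>\<theta>. y \<theta> (b, i))) \<le> 1"
      using feas that by (simp add: lp_feasible_def)
    then show ?thesis using nonneg[of i] by linarith
  qed
  show "frac_matching B1 I E x"
    using feas le by (simp add: lp_feasible_def frac_matching_def del: split_paired_All)
  show "\<theta> \<in> set_pmf D \<Longrightarrow> frac_matching B2 I (E2 \<theta>) (y \<theta>)"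
    using feas by (simp add: lp_feasible_def frac_matching_def del: split_paired_All)
qed

text \<open>Equivalent to \<open>4 * X * Y \<le> X + Y\<close>. Equality at
  \<open>X = Y = 1/2\<close> shows that the constant cannot be raised in this inequality.\<close>

lemma three_quarters_le:
  fixes X Y :: real
  assumes "0 \<le> X" "0 \<le> Y" "X + Y \<le> 1"
  shows "3 / 4 * (X + Y) \<le> X + (1 - X) * Y"
proof -
  have "4 * (X * Y) \<le> (X + Y)\<^sup>2" using sum_squares_bound[of X Y] by (simp add: power2_sum)
  also have "\<dots> \<le> X + Y"
    using assms mult_left_le[of "X + Y" "X + Y"] by (simp add: power2_eq_square)
  finally show ?thesis by (simp add: field_simps)
qed

text \<open>At each offline node the size is affine in the indicators of \<open>M2\<close> for fixed
  \<open>M1\<close>, and affine in those of \<open>M1\<close> once the second stage is averaged.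
  Only edge marginals therefore enter, whatever the correlations within a stage.\<close>

lemma two_stage_rounding_expectation:
  assumes fin: "finite I" "finite B1" "finite B2" and disj: "B1 \<inter> B2 = {}"
    and D: "finite (set_pmf D)"
    and E: "E \<subseteq> B1 \<times> I" and E2: "\<And>\<theta>. \<theta> \<in> set_pmf D \<Longrightarrow> E2 \<theta> \<subseteq> B2 \<times> I"
    and feas: "lp_feasible I B1 B2 E E2 D x y"
    and P: "two_stage_rounding I B1 B2 E E2 D x y P"
  shows "\<forall>(\<theta>, M) \<in> set_pmf P. matching (E \<union> E2 \<theta>) M"
    and "measure_pmf.expectation P (\<lambda>(\<theta>, M). real (card M)) =
      (\<Sum>i\<in>I. (\<Sum>a\<in>B1. x (a, i)) + (1 - (\<Sum>a\<in>B1. x (a, i))) *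
        (\<Sum>b\<in>B2. measure_pmf.expectation D (\<lambda>\<theta>. y \<theta> (b, i))))"
proof -
  obtain p q where p: "dep_rounding B1 I E x p"
    and q: "\<And>\<theta>. \<theta> \<in> set_pmf D \<Longrightarrow> dep_rounding B2 I (E2 \<theta>) (y \<theta>) (q \<theta>)"
    and P: "P = bind_pmf p (\<lambda>M1. bind_pmf D (\<lambda>\<theta>. bind_pmf (q \<theta>) (\<lambda>M2.
              return_pmf (\<theta>, combine_stages M1 M2))))"
    using P by (auto simp: two_stage_rounding_def)
  note frac = lp_feasible_frac_matching[OF feas]
  have pm: "matching E M1" if "M1 \<in> set_pmf p" for M1
    using dep_rounding_matching_marginal[OF fin(2,1) E p frac(1)] that by blast
  have pe: "measure_pmf.expectation p (\<lambda>M. of_bool (e \<in> M)) = x e" for e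
    using dep_rounding_matching_marginal[OF fin(2,1) E p frac(1)] by blast
  have qm: "matching (E2 \<theta>) M2" if "\<theta> \<in> set_pmf D" "M2 \<in> set_pmf (q \<theta>)" for \<theta> M2
    using dep_rounding_matching_marginal[OF fin(3,1) E2[OF that(1)] q[OF that(1)] frac(2)[OF that(1)]]
      that by blast
  have qe: "measure_pmf.expectation (q \<theta>) (\<lambda>M. of_bool (e \<in> M)) = y \<theta> e" if "\<theta> \<in> set_pmf D" for \<theta> e
    using dep_rounding_matching_marginal[OF fin(3,1) E2[OF that] q[OF that] frac(2)[OF that]] by blast
  show "\<forall>(\<theta>, M) \<in> set_pmf P. matching (E \<union> E2 \<theta>) M"
    using matching_combine_stages[OF disj E E2 pm qm] by (auto simp: P)
  have "set_pmf p \<subseteq> Pow (B1 \<times> I)" using pm E unfolding matching_def by blast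
  then have finp: "finite (set_pmf p)" using fin by (simp add: finite_subset)
  have "set_pmf (q \<theta>) \<subseteq> Pow (B2 \<times> I)" if "\<theta> \<in> set_pmf D" for \<theta>
    using qm[OF that] E2[OF that] unfolding matching_def by blast
  then have finq: "finite (set_pmf (q \<theta>))" if "\<theta> \<in> set_pmf D" for \<theta>
    using fin that by (meson finite_Pow_iff finite_SigmaI finite_subset)
  note int = integrable_measure_pmf_finite
  note linear = Bochner_Integration.integral_add Bochner_Integration.integral_sum
    Bochner_Integration.integral_diff
  let ?A = "\<lambda>i M. \<Sum>a\<in>B1. of_bool ((a, i) \<in> M) :: real"
  let ?Y = "\<lambda>i. \<Sum>b\<in>B2. measure_pmf.expectation D (\<lambda>\<theta>. y \<theta> (b, i))"
  \<comment> \<open>Here \<open>M1\<close> and \<open>\<theta>\<close> are fixed;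
    \<open>q \<theta>\<close> does not depend on \<open>M1\<close>, so the factor for free nodes is
    a constant.\<close>
  have stage2: "measure_pmf.expectation (q \<theta>) (\<lambda>M2. real (card (combine_stages M1 M2))) =
      (\<Sum>i\<in>I. ?A i M1 + (1 - ?A i M1) * (\<Sum>b\<in>B2. y \<theta> (b, i)))"
    if "M1 \<in> set_pmf p" "\<theta> \<in> set_pmf D" for M1 \<theta>
  proof -
    have "measure_pmf.expectation (q \<theta>) (\<lambda>M2. real (card (combine_stages M1 M2))) =
      measure_pmf.expectation (q \<theta>) (\<lambda>M2. \<Sum>i\<in>I. ?A i M1 + (1 - ?A i M1) * (\<Sum>b\<in>B2. of_bool ((b, i) \<in> M2)))"
      using qm[OF that(2)]
      by (intro pmf_expectation_cong card_combine_stages[OF fin(2,3,1) disj E E2[OF that(2)] pm[OF that(1)]])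
         (simp add: matching_def)
    also have "\<dots> = (\<Sum>i\<in>I. ?A i M1 + (1 - ?A i M1) * (\<Sum>b\<in>B2. y \<theta> (b, i)))"
      by (simp add: linear int[OF finq[OF that(2)]] qe[OF that(2)])
    finally show ?thesis .
  qed
  let ?h = "\<lambda>(\<theta>, M). real (card M)"
  let ?Q = "\<lambda>M1 \<theta>. map_pmf (\<lambda>M2. (\<theta>, combine_stages M1 M2)) (q \<theta>)"
  have P': "P = bind_pmf p (\<lambda>M1. bind_pmf D (?Q M1))"
    by (simp add: P map_pmf_def)
  have finQ: "finite (set_pmf (?Q M1 \<theta>))" if "\<theta> \<in> set_pmf D" for M1 \<theta>
    using finq[OF that] by simp
  have "measure_pmf.expectation P ?h =
      measure_pmf.expectation p (\<lambda>M1. measure_pmf.expectation (bind_pmf D (?Q M1)) ?h)"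
    unfolding P' by (rule pmf_expectation_bind_finite[OF finp]) (simp add: D finq)
  also have "\<dots> = measure_pmf.expectation p (\<lambda>M1. measure_pmf.expectation D (\<lambda>\<theta>.
        measure_pmf.expectation (?Q M1 \<theta>) ?h))"
    by (intro pmf_expectation_cong pmf_expectation_bind_finite[OF D] finQ)
  also have "\<dots> = measure_pmf.expectation p (\<lambda>M1. measure_pmf.expectation D (\<lambda>\<theta>.
        measure_pmf.expectation (q \<theta>) (\<lambda>M2. real (card (combine_stages M1 M2)))))"
    by simp
  also have "\<dots> = measure_pmf.expectation p (\<lambda>M1. measure_pmf.expectation D (\<lambda>\<theta>.
        \<Sum>i\<in>I. ?A i M1 + (1 - ?A i M1) * (\<Sum>b\<in>B2. y \<theta> (b, i))))"
    by (intro pmf_expectation_cong stage2)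
  \<comment> \<open>Averaging over \<open>\<theta>\<close> replaces the second-stage load by its
    mean; the next step averages over \<open>M1\<close> and inserts the marginals
    \<open>x\<close>.\<close>
  also have "\<dots> = measure_pmf.expectation p (\<lambda>M1. \<Sum>i\<in>I. ?A i M1 + (1 - ?A i M1) * ?Y i)"
    by (simp add: linear int[OF D])
  also have "\<dots> = (\<Sum>i\<in>I. (\<Sum>a\<in>B1. x (a, i)) + (1 - (\<Sum>a\<in>B1. x (a, i))) * ?Y i)"
    by (simp add: linear int[OF finp] pe)
  finally show "measure_pmf.expectation P (\<lambda>(\<theta>, M). real (card M)) =
      (\<Sum>i\<in>I. (\<Sum>a\<in>B1. x (a, i)) + (1 - (\<Sum>a\<in>B1. x (a, i))) * ?Y i)" .
qed

lemma two_stage_rounding_exists: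
  assumes fin: "finite I" "finite B1" "finite B2"
    and E: "E \<subseteq> B1 \<times> I" and E2: "\<And>\<theta>. \<theta> \<in> set_pmf D \<Longrightarrow> E2 \<theta> \<subseteq> B2 \<times> I"
    and feas: "lp_feasible I B1 B2 E E2 D x y"
  shows "\<exists>P. two_stage_rounding I B1 B2 E E2 D x y P"
proof -
  note frac = lp_feasible_frac_matching[OF feas]
  obtain p where "dep_rounding B1 I E x p"
    using dep_rounding_exists[OF fin(2,1) E frac(1)] by blast
  moreover have "\<forall>\<theta>\<in>set_pmf D. \<exists>r. dep_rounding B2 I (E2 \<theta>) (y \<theta>) r"
    using dep_rounding_exists[OF fin(3,1) E2 frac(2)] by blast
  \<comment> \<open>One rounding law is chosen per scenario in the support; elsewhere
    \<open>q\<close> is arbitrary.\<close>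
  then obtain q where "\<forall>\<theta>\<in>set_pmf D. dep_rounding B2 I (E2 \<theta>) (y \<theta>) (q \<theta>)"
    by (rule bchoice[THEN exE])
  ultimately show ?thesis unfolding two_stage_rounding_def by blast
qed

text \<open>An optimal solution attains the supremum, so \<open>Sup\<close> is a genuine maximum
  here.\<close>

lemma lp_off_eq_lp_value:
  assumes "lp_optimal I B1 B2 E E2 D x y"
  shows "lp_off I B1 B2 E E2 D = lp_value I B1 B2 D x y"
  unfolding lp_off_def using assms by (intro cSup_eq_maximum) (auto simp: lp_optimal_def)

text \<open>The guarantee covers every admissible choice of cycles and paths, hence the
  quantification over all \<open>P\<close>; the existence part shows that it is not vacuous.\<close>

theorem theorem6:
  fixes I :: "'i set" and B1 B2 :: "'b set"
    and E :: "('b \<times> 'i) set" and E2 :: "'t \<Rightarrow> ('b \<times> 'i) set" and D :: "'t pmf"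
    and x :: "'b \<times> 'i \<Rightarrow> real" and y :: "'t \<Rightarrow> 'b \<times> 'i \<Rightarrow> real"
  assumes "finite I" "finite B1" "finite B2" "B1 \<inter> B2 = {}"
    and "finite (set_pmf D)"
    and "E \<subseteq> B1 \<times> I" and "\<And>\<theta>. \<theta> \<in> set_pmf D \<Longrightarrow> E2 \<theta> \<subseteq> B2 \<times> I"
    and "lp_optimal I B1 B2 E E2 D x y"
  shows "(\<exists>P. two_stage_rounding I B1 B2 E E2 D x y P) \<and>
    (\<forall>P. two_stage_rounding I B1 B2 E E2 D x y P \<longrightarrow>
       (\<forall>(\<theta>, M) \<in> set_pmf P. matching (E \<union> E2 \<theta>) M) \<and>
       measure_pmf.expectation P (\<lambda>(\<theta>, M). real (card M)) \<ge> 3 / 4 * lp_off I B1 B2 E E2 D \<and>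
       measure_pmf.expectation P (\<lambda>(\<theta>, M). real (card M)) \<ge> 3 / 4 * opt_off E E2 D)"
proof -
  have feas: "lp_feasible I B1 B2 E E2 D x y" using assms(8) by (simp add: lp_optimal_def)
  have opt: "opt_off E E2 D \<le> lp_off I B1 B2 E E2 D"
  proof -
    obtain x' y' where "lp_feasible I B1 B2 E E2 D x' y'" "opt_off E E2 D = lp_value I B1 B2 D x' y'"
      by (rule opt_off_as_lp_value[OF assms(1-7)])
    with assms(8) show ?thesis
      unfolding lp_off_eq_lp_value[OF assms(8)] by (simp add: lp_optimal_def)
  qed
  let ?X = "\<lambda>i. \<Sum>a\<in>B1. x (a, i)"
  let ?Y = "\<lambda>i. \<Sum>b\<in>B2. measure_pmf.expectation D (\<lambda>\<theta>. y \<theta> (b, i))"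
  have "3 / 4 * lp_off I B1 B2 E E2 D = (\<Sum>i\<in>I. 3 / 4 * (?X i + ?Y i))"
    unfolding lp_off_eq_lp_value[OF assms(8)] lp_value_def
    by (simp only: sum.distrib[symmetric] sum_distrib_left[symmetric])
  \<comment> \<open>The bound holds node by node, with the joint offline constraint supplying
    \<open>X + Y \<le> 1\<close>.\<close>
  also have "\<dots> \<le> (\<Sum>i\<in>I. ?X i + (1 - ?X i) * ?Y i)"
  proof (intro sum_mono three_quarters_le)
    fix i assume "i \<in> I"
    then show "?X i + ?Y i \<le> 1" using feas by (simp add: lp_feasible_def)
    show "0 \<le> ?X i" "0 \<le> ?Y i"
      using feas by (auto simp: lp_feasible_def AE_measure_pmf_iff intro!: sum_nonneg integral_nonneg_AE)
  qed
  finally have bound: "3 / 4 * lp_off I B1 B2 E E2 D \<le> measure_pmf.expectation P (\<lambda>(\<theta>, M). real (card M))"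
    if "two_stage_rounding I B1 B2 E E2 D x y P" for P
    using two_stage_rounding_expectation(2)[OF assms(1-7) feas that] by simp
  show ?thesis
  proof (intro conjI allI impI)
    show "\<exists>P. two_stage_rounding I B1 B2 E E2 D x y P"
      by (rule two_stage_rounding_exists[OF assms(1-3,6,7) feas])
    fix P assume P: "two_stage_rounding I B1 B2 E E2 D x y P"
    show "\<forall>(\<theta>, M) \<in> set_pmf P. matching (E \<union> E2 \<theta>) M"
      by (rule two_stage_rounding_expectation(1)[OF assms(1-7) feas P])
    show "measure_pmf.expectation P (\<lambda>(\<theta>, M). real (card M)) \<ge> 3 / 4 * lp_off I B1 B2 E E2 D"
      by (rule bound[OF P])
    then show "measure_pmf.expectation P (\<lambda>(\<theta>, M). real (card M)) \<ge> 3 / 4 * opt_off E E2 D"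
      using opt by linarith
  qed
qed

end
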